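(* Let $\gamma: I\to M(p)$ be a non-constant geodesic in $(M(p),g_M)$, defined on an interval $I$. Then $F\circ\gamma: I\to\mathrm{Sym}^+(p)$ is either an immersion or a constant map.
   Context: Let $p\ge 2$. $\mathrm{Sym}^+(p)$ is the set of $p\times p$ real symmetric positive-definite matrices, $\mathrm{Diag}^+(p)$ the set of $p\times p$ diagonal matrices with positive diagonal entries, $M(p)=SO(p)\times \mathrm{Diag}^+(p)$, and $F:M(p)\to \mathrm{Sym}^+(p)$ is $F(U,D)=UDU^T$. $SO(p)$ carries the bi-invariant Riemannian metric $g_{SO}$ given at the identity by $g_{SO}(A_1,A_2)=-\frac12\mathrm{tr}(A_1A_2)$; $\mathrm{Diag}^+(p)$ carries the metric $g_{\mathcal{D}^+}|_D(L_1,L_2)=\mathrm{tr}(D^{-1}L_1D^{-1}L_2)$ for $L_1,L_2$ diagonal; $M(p)$ carries the product metric $g_M=k\,g_{SO}\oplus g_{\mathcal{D}^+}$ with fixed $k>0$. (The geodesics of $(M(p),g_M)$ are, up to translating the parameter, the curves $t\mapsto(e^{tA}U,e^{tL}D)$ with $(U,D)\in M(p)$, $A\in\mathfrak{so}(p)$ and $L$ a diagonal matrix.) *)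

theory Defs
  imports "HOL-Analysis.Analysis"
begin

(* At points of S on its boundary the derivatives are one-sided (at x within S). The definition
   is meant for sets with nonempty interior that are convex, where derivatives are unique. *)
primrec Ck_on :: "nat \<Rightarrow> ('a::euclidean_space \<Rightarrow> 'b::real_normed_vector) \<Rightarrow> 'a set \<Rightarrow> bool" where
  "Ck_on 0 f S \<longleftrightarrow> continuous_on S f"
| "Ck_on (Suc n) f S \<longleftrightarrow>
     (\<exists>f'. (\<forall>x\<in>S. (f has_derivative f' x) (at x within S)) \<and>
           (\<forall>i\<in>Basis. Ck_on n (\<lambda>x. f' x i) S))"

definition smooth_on :: "'a::euclidean_space set \<Rightarrow> ('a \<Rightarrow> 'b::real_normed_vector) \<Rightarrow> bool" where
  "smooth_on S f \<longleftrightarrow> (\<forall>n. Ck_on n f S)"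

definition immersion_on :: "'a::euclidean_space set \<Rightarrow> ('a \<Rightarrow> 'b::real_normed_vector) \<Rightarrow> bool" where
  "immersion_on S f \<longleftrightarrow>
     smooth_on S f \<and> (\<forall>x\<in>S. \<exists>f'. (f has_derivative f') (at x within S) \<and> inj f')"

(* Riemannian geodesics on a submanifold M of a Euclidean space. M carries a metric g, where
   g x v w is only meant for x in M and v, w tangent to M at x. Smoothness of a map into M is
   smoothness of the map into the ambient space. Geodesics are the smooth curves that are
   critical for the energy, on every compact subinterval, under all smooth variations in M with
   fixed endpoints. They are thus affinely parametrized, and constant curves are geodesics. *)
definition energy ::
    "('a::euclidean_space \<Rightarrow> 'a \<Rightarrow> 'a \<Rightarrow> real) \<Rightarrow> real \<Rightarrow> real \<Rightarrow> (real \<Rightarrow> 'a) \<Rightarrow> real" where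
  "energy g a b c = 1 / 2 * integral {a..b}
     (\<lambda>t. g (c t) (vector_derivative c (at t within {a..b}))
                  (vector_derivative c (at t within {a..b})))"

definition proper_variation ::
    "'a::euclidean_space set \<Rightarrow> real \<Rightarrow> real \<Rightarrow> (real \<Rightarrow> 'a) \<Rightarrow> real \<Rightarrow> (real \<times> real \<Rightarrow> 'a) \<Rightarrow> bool" where
  "proper_variation M a b c \<epsilon> \<Gamma> \<longleftrightarrow>
     \<epsilon> > 0 \<and>
     smooth_on ({-\<epsilon><..<\<epsilon>} \<times> {a..b}) \<Gamma> \<and>
     \<Gamma> ` ({-\<epsilon><..<\<epsilon>} \<times> {a..b}) \<subseteq> M \<and>
     (\<forall>t\<in>{a..b}. \<Gamma> (0, t) = c t) \<and>
     (\<forall>s\<in>{-\<epsilon><..<\<epsilon>}. \<Gamma> (s, a) = c a \<and> \<Gamma> (s, b) = c b)"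

definition geodesic_on ::
    "'a::euclidean_space set \<Rightarrow> ('a \<Rightarrow> 'a \<Rightarrow> 'a \<Rightarrow> real) \<Rightarrow> real set \<Rightarrow> (real \<Rightarrow> 'a) \<Rightarrow> bool" where
  "geodesic_on M g I c \<longleftrightarrow>
     smooth_on I c \<and> c ` I \<subseteq> M \<and>
     (\<forall>a b \<epsilon> \<Gamma>. a < b \<longrightarrow> {a..b} \<subseteq> I \<longrightarrow> proper_variation M a b c \<epsilon> \<Gamma> \<longrightarrow>
        ((\<lambda>s. energy g a b (\<lambda>t. \<Gamma> (s, t))) has_real_derivative 0) (at 0))"

definition SO :: "(real^'p^'p) set" where
  "SO = {U. rotation_matrix U}"

definition Diag_pos :: "(real^'p^'p) set" where
  "Diag_pos = {D. (\<forall>i j. i \<noteq> j \<longrightarrow> D $ i $ j = 0) \<and> (\<forall>i. D $ i $ i > 0)}"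

definition Sym_pos :: "(real^'p^'p) set" where
  "Sym_pos = {S. transpose S = S \<and> (\<forall>x. x \<noteq> 0 \<longrightarrow> x \<bullet> (S *v x) > 0)}"

definition M :: "((real^'p^'p) \<times> (real^'p^'p)) set" where
  "M = SO \<times> Diag_pos"

definition F :: "(real^'p^'p) \<times> (real^'p^'p) \<Rightarrow> real^'p^'p" where
  "F = (\<lambda>(U, D). U ** D ** transpose U)"

(* The form -1/2 tr(A1 A2) on skew-symmetric matrices, moved to U by left translation; it is
   Ad-invariant, so right translation gives the same metric. *)
definition g_SO :: "real^'p^'p \<Rightarrow> real^'p^'p \<Rightarrow> real^'p^'p \<Rightarrow> real" where
  "g_SO U X Y = - (1 / 2) * trace ((transpose U ** X) ** (transpose U ** Y))"

definition g_Diag :: "real^'p^'p \<Rightarrow> real^'p^'p \<Rightarrow> real^'p^'p \<Rightarrow> real" where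
  "g_Diag D L\<^sub>1 L\<^sub>2 = trace (matrix_inv D ** L\<^sub>1 ** matrix_inv D ** L\<^sub>2)"

definition g_M :: "real \<Rightarrow> (real^'p^'p) \<times> (real^'p^'p) \<Rightarrow> (real^'p^'p) \<times> (real^'p^'p) \<Rightarrow>
    (real^'p^'p) \<times> (real^'p^'p) \<Rightarrow> real" where
  "g_M k = (\<lambda>(U, D) (X, L\<^sub>1) (Y, L\<^sub>2). k * g_SO U X Y + g_Diag D L\<^sub>1 L\<^sub>2)"

end

theory Submission
  imports Defs
begin

text \<open>
  Write the geodesic as $(U(t), D(t))$, with logarithmic derivatives $X = U^T U'$, which is skew, and
  $\Lambda = D^{-1}D'$, which is diagonal. For this invariant metric $X$ and $\Lambda$ are constant
  along a geodesic, and the theorem follows from these two conservation laws.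

  Differentiating,
  \[ (F \circ \gamma)' = U Z U^T, \quad Z = X D - D X + D'. \]
  Suppose this vanishes at one time $t_0$. The commutator $XD - DX$ has zero diagonal because $D$ is
  diagonal, so the diagonal of $Z$ is $D'$ and hence $D'(t_0) = 0$, thus $\Lambda(t_0) = 0$. Since
  $\Lambda$ is constant, $D' = 0$ at all times and $D$ is constant. Also $X$ commutes with $D$ at
  $t_0$; as both are constant they commute always, $Z$ vanishes identically, and $F \circ \gamma$ is
  constant. Otherwise the velocity of $F \circ \gamma$ never vanishes, which is the immersion property.

  Geodesics are given as critical curves of the energy, so the constancy of $X$ and $\Lambda$ has to
  be derived from variations. Right translation by a one-parameter group, with a time-dependent
  parameter $s\varphi(t)$, varies the curve inside the manifold and changes the energy by an explicit
  quadratic polynomial in $s$ (lemma \<open>first_variation\<close>). The fundamental lemma of the calculus of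
  variations (lemma \<open>du_Bois_Reymond\<close>) then makes each momentum constant (lemma
  \<open>conserved_momentum\<close>). Rotations of coordinate planes yield the entries of $X$, and dilations of
  coordinate axes the diagonal entries of $\Lambda$.
\<close>

section \<open>Closure properties of smooth maps\<close>

lemma Ck_on_SucE:
  assumes "Ck_on (Suc n) f S"
  obtains f' where "\<forall>x\<in>S. (f has_derivative f' x) (at x within S)"
    and "\<forall>i\<in>Basis. Ck_on n (\<lambda>x. f' x i) S"
  using assms unfolding Ck_on.simps by (elim exE conjE)

lemma Ck_on_SucI:
  assumes "\<forall>x\<in>S. (f has_derivative f' x) (at x within S)"
    and "\<forall>i\<in>Basis. Ck_on n (\<lambda>x. f' x i) S"
  shows "Ck_on (Suc n) f S"
  unfolding Ck_on.simps using assms by (intro exI[of _ f'] conjI)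

lemma Ck_on_cong:
  assumes "Ck_on n f S" and "\<And>x. x \<in> S \<Longrightarrow> g x = f x"
  shows "Ck_on n g S"
proof (cases n)
  case 0
  then show ?thesis using assms by (simp cong: continuous_on_cong)
next
  case (Suc m)
  with assms(1) obtain f' where f': "\<forall>x\<in>S. (f has_derivative f' x) (at x within S)"
    "\<forall>i\<in>Basis. Ck_on m (\<lambda>x. f' x i) S"
    by (auto elim: Ck_on_SucE simp del: Ck_on.simps)
  have "\<forall>x\<in>S. (g has_derivative f' x) (at x within S)"
    using f'(1) assms(2) by (intro ballI has_derivative_transform[of _ S g f]) simp_all
  then show ?thesis unfolding Suc using f'(2) by (rule Ck_on_SucI)
qed

lemma Ck_on_subset:
  assumes "Ck_on n f S" and "T \<subseteq> S"
  shows "Ck_on n f T"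
  using assms(1)
proof (induction n arbitrary: f)
  case 0
  then show ?case using assms(2) by (simp add: continuous_on_subset)
next
  case (Suc n)
  obtain f' where f': "\<forall>x\<in>S. (f has_derivative f' x) (at x within S)"
    "\<forall>i\<in>Basis. Ck_on n (\<lambda>x. f' x i) S"
    using Suc.prems by (rule Ck_on_SucE)
  have "\<forall>x\<in>T. (f has_derivative f' x) (at x within T)"
    using f'(1) assms(2) has_derivative_subset by blast
  moreover have "\<forall>i\<in>Basis. Ck_on n (\<lambda>x. f' x i) T"
    using f'(2) Suc.IH by blast
  ultimately show ?case by (rule Ck_on_SucI)
qed

lemma Ck_on_SucD: "Ck_on (Suc n) f S \<Longrightarrow> Ck_on n f S"
proof (induction n arbitrary: f)
  case 0
  then show ?case
    by (auto simp: continuous_on_eq_continuous_within intro: has_derivative_continuous)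
next
  case (Suc n)
  obtain f' where
    f': "\<forall>x\<in>S. (f has_derivative f' x) (at x within S)"
      "\<forall>i\<in>Basis. Ck_on (Suc n) (\<lambda>x. f' x i) S"
    using Suc.prems by (rule Ck_on_SucE)
  have "\<forall>i\<in>Basis. Ck_on n (\<lambda>x. f' x i) S"
    using f'(2) Suc.IH by blast
  then show ?case using f'(1) by (intro Ck_on_SucI)
qed

lemma Ck_on_const: "Ck_on n (\<lambda>x. c) S"
proof (induction n arbitrary: c)
  case (Suc n)
  have "\<forall>x\<in>S. ((\<lambda>x. c) has_derivative (\<lambda>h. 0)) (at x within S)"
    by simp
  then show ?case using Suc[of 0] by (intro Ck_on_SucI[where f' = "\<lambda>x h. 0"] ballI) simp_all
qed simp

lemma Ck_on_add:
  assumes "Ck_on n f S" and "Ck_on n g S"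
  shows "Ck_on n (\<lambda>x. f x + g x) S"
  using assms
proof (induction n arbitrary: f g)
  case 0
  then show ?case by (simp add: continuous_on_add)
next
  case (Suc n)
  obtain f' where f': "\<forall>x\<in>S. (f has_derivative f' x) (at x within S)"
    "\<forall>i\<in>Basis. Ck_on n (\<lambda>x. f' x i) S"
    using Suc.prems(1) by (rule Ck_on_SucE)
  obtain g' where g': "\<forall>x\<in>S. (g has_derivative g' x) (at x within S)"
    "\<forall>i\<in>Basis. Ck_on n (\<lambda>x. g' x i) S"
    using Suc.prems(2) by (rule Ck_on_SucE)
  have "\<forall>x\<in>S. ((\<lambda>x. f x + g x) has_derivative (\<lambda>h. f' x h + g' x h)) (at x within S)"
    using f'(1) g'(1) by (blast intro: has_derivative_add)
  moreover have "\<forall>i\<in>Basis. Ck_on n (\<lambda>x. f' x i + g' x i) S"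
    using Suc.IH f'(2) g'(2) by blast
  ultimately show ?case by (rule Ck_on_SucI)
qed

lemma Ck_on_bounded_linear:
  assumes "bounded_linear L" and "Ck_on n f S"
  shows "Ck_on n (\<lambda>x. L (f x)) S"
  using assms(2)
proof (induction n arbitrary: f)
  case 0
  then show ?case using assms(1) by (simp add: bounded_linear.continuous_on)
next
  case (Suc n)
  obtain f' where f': "\<forall>x\<in>S. (f has_derivative f' x) (at x within S)"
    "\<forall>i\<in>Basis. Ck_on n (\<lambda>x. f' x i) S"
    using Suc.prems by (rule Ck_on_SucE)
  have "\<forall>x\<in>S. ((\<lambda>x. L (f x)) has_derivative (\<lambda>h. L (f' x h))) (at x within S)"
    using f'(1) bounded_linear.has_derivative[OF assms(1)] by blast
  then show ?case
    using f'(2) Suc.IH by (intro Ck_on_SucI[where f' = "\<lambda>x h. L (f' x h)"]) simp_all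
qed

lemma Ck_on_bounded_bilinear:
  assumes B: "bounded_bilinear B" and "Ck_on n f S" and "Ck_on n g S"
  shows "Ck_on n (\<lambda>x. B (f x) (g x)) S"
  using assms(2,3)
proof (induction n arbitrary: f g)
  case 0
  then show ?case using B by (simp add: bounded_bilinear.continuous_on)
next
  case (Suc n)
  obtain f' where f': "\<forall>x\<in>S. (f has_derivative f' x) (at x within S)"
    "\<forall>i\<in>Basis. Ck_on n (\<lambda>x. f' x i) S"
    using Suc.prems(1) by (rule Ck_on_SucE)
  obtain g' where g': "\<forall>x\<in>S. (g has_derivative g' x) (at x within S)"
    "\<forall>i\<in>Basis. Ck_on n (\<lambda>x. g' x i) S"
    using Suc.prems(2) by (rule Ck_on_SucE)
  let ?d = "\<lambda>x h. B (f x) (g' x h) + B (f' x h) (g x)"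
  have "\<forall>x\<in>S. ((\<lambda>x. B (f x) (g x)) has_derivative ?d x) (at x within S)"
    using f'(1) g'(1) bounded_bilinear.FDERIV[OF B] by blast
  moreover have "\<forall>i\<in>Basis. Ck_on n (\<lambda>x. ?d x i) S"
    using f'(2) g'(2) Suc.prems[THEN Ck_on_SucD] by (intro ballI Ck_on_add Suc.IH) simp_all
  ultimately show ?case by (rule Ck_on_SucI)
qed

lemma Ck_on_Pair:
  assumes "Ck_on n f S" and "Ck_on n g S"
  shows "Ck_on n (\<lambda>x. (f x, g x)) S"
proof -
  have "Ck_on n (\<lambda>x. (f x, 0) + (0, g x)) S"
    using assms
    by (intro Ck_on_add Ck_on_bounded_linear[where L = "\<lambda>x. (x, 0)"]
        Ck_on_bounded_linear[where L = "\<lambda>x. (0, x)"] bounded_linear_Pair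
        bounded_linear_ident bounded_linear_zero)
  then show ?thesis by simp
qed

text \<open>The derivative of $1/f$ is polynomial in $1/f$ and $f'$, so differentiability to order $n+1$
  follows from order $n$ of $1/f$ itself.\<close>
lemma Ck_on_inverse:
  fixes f :: "'a::euclidean_space \<Rightarrow> real"
  assumes "Ck_on n f S" and nz: "\<And>x. x \<in> S \<Longrightarrow> f x \<noteq> 0"
  shows "Ck_on n (\<lambda>x. inverse (f x)) S"
  using assms(1)
proof (induction n)
  case 0
  then show ?case using nz by (simp add: continuous_on_inverse)
next
  case (Suc n)
  obtain f' where f': "\<forall>x\<in>S. (f has_derivative f' x) (at x within S)"
    "\<forall>i\<in>Basis. Ck_on n (\<lambda>x. f' x i) S"
    using Suc.prems(1) by (rule Ck_on_SucE)
  have "\<forall>x\<in>S. ((\<lambda>x. inverse (f x)) has_derivative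
      (\<lambda>h. - (inverse (f x) * f' x h * inverse (f x)))) (at x within S)"
    using f'(1) nz by (intro ballI has_derivative_inverse) simp_all
  moreover have "\<forall>i\<in>Basis. Ck_on n (\<lambda>x. - (inverse (f x) * f' x i * inverse (f x))) S"
    using f'(2) Suc.IH[OF Ck_on_SucD[OF Suc.prems]]
    by (intro ballI Ck_on_bounded_linear[OF bounded_linear_minus[OF bounded_linear_ident]]
        Ck_on_bounded_bilinear[OF bounded_bilinear_mult]) auto
  ultimately show ?case by (rule Ck_on_SucI)
qed

lemma Ck_on_Suc_real:
  assumes "\<And>t. t \<in> S \<Longrightarrow> (f has_vector_derivative f' t) (at t within S)" and "Ck_on n f' S"
  shows "Ck_on (Suc n) f S"
  using assms by (intro Ck_on_SucI[where f' = "\<lambda>t h. h *\<^sub>R f' t"])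
    (simp_all add: has_vector_derivative_def)

lemma Ck_on_fst: "Ck_on n fst S" and Ck_on_snd: "Ck_on n snd S"
proof -
  show "Ck_on n fst S"
  proof (cases n)
    case (Suc m)
    then show ?thesis
      by (auto intro!: Ck_on_SucI[where f' = "\<lambda>x. fst"] has_derivative_fst Ck_on_const
          simp del: Ck_on.simps)
  qed (simp add: continuous_on_fst)
  show "Ck_on n snd S"
  proof (cases n)
    case (Suc m)
    then show ?thesis
      by (auto intro!: Ck_on_SucI[where f' = "\<lambda>x. snd"] has_derivative_snd Ck_on_const
          simp del: Ck_on.simps)
  qed (simp add: continuous_on_snd)
qed

text \<open>Variations are functions of the pair (parameter, time); this lets data along the curve, which
  depend on time only, enter them.\<close>
lemma Ck_on_compose_snd:
  fixes f :: "real \<Rightarrow> 'b::real_normed_vector" and T :: "real set"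
  assumes "Ck_on n f S"
  shows "Ck_on n (\<lambda>x. f (snd x)) (T \<times> S)"
  using assms
proof (induction n arbitrary: f)
  case 0
  then show ?case
    by (auto intro!: continuous_on_compose2[where g = f and t = S] continuous_intros)
next
  case (Suc n)
  obtain f' where f': "\<forall>x\<in>S. (f has_derivative f' x) (at x within S)"
    "\<forall>i\<in>Basis. Ck_on n (\<lambda>x. f' x i) S"
    using Suc.prems by (rule Ck_on_SucE)
  have "((\<lambda>x. f (snd x)) has_derivative (\<lambda>h. snd h *\<^sub>R f' (snd x) 1)) (at x within T \<times> S)"
    if x: "x \<in> T \<times> S" for x
  proof -
    have lin: "linear (f' (snd x))"
      using f'(1) x has_derivative_linear[of f "f' (snd x)"] by (auto simp: mem_Times_iff)
    have "((\<lambda>x. f (snd x)) has_derivative (\<lambda>h. f' (snd x) (snd h))) (at x within T \<times> S)"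
      using f'(1) x
      by (intro has_derivative_in_compose2[where t = S and f = snd and g' = f']
          has_derivative_snd[OF has_derivative_ident]) auto
    moreover have "f' (snd x) r = r *\<^sub>R f' (snd x) 1" for r
      using linear_scale[OF lin, of r 1] by simp
    then have "(\<lambda>h. f' (snd x) (snd h)) = (\<lambda>h. snd h *\<^sub>R f' (snd x) 1)"
      by (rule ext)
    ultimately show ?thesis by (rule has_derivative_eq_rhs)
  qed
  moreover have "Ck_on n (\<lambda>x. snd i *\<^sub>R f' (snd x) 1) (T \<times> S)" for i :: "real \<times> real"
    using Suc.IH[of "\<lambda>t. f' t 1"] f'(2) by (intro Ck_on_bounded_linear[OF bounded_linear_scaleR_right]) simp
  ultimately show ?case
    by (intro Ck_on_SucI[where f' = "\<lambda>x h. snd h *\<^sub>R f' (snd x) 1"] ballI)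
qed

section \<open>Matrix operations as bounded linear and bilinear maps\<close>

lemma bounded_bilinear_matrix_mult:
  "bounded_bilinear ((**) :: real^'m^'n \<Rightarrow> real^'p^'m \<Rightarrow> real^'p^'n)"
proof -
  have *: "(A + A') ** B = A ** B + A' ** B" "(c *\<^sub>R A) ** B = c *\<^sub>R (A ** B)" "A ** (c *\<^sub>R B) = c *\<^sub>R (A ** B)"
    for A A' :: "real^'m^'n" and B :: "real^'p^'m" and c
    by (simp_all add: algebra_simps sum.distrib matrix_matrix_mult_def vec_eq_iff sum_distrib_left mult.assoc mult.left_commute)
  have "bilinear ((**) :: real^'m^'n \<Rightarrow> real^'p^'m \<Rightarrow> real^'p^'n)"
    unfolding bilinear_def
    by (intro conjI allI linearI) (simp_all add: matrix_add_ldistrib *)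
  then show ?thesis by (simp add: bilinear_conv_bounded_bilinear)
qed

interpretation matrix_mult: bounded_bilinear
  "(**) :: real^'m^'n \<Rightarrow> real^'p^'m \<Rightarrow> real^'p^'n"
  by (rule bounded_bilinear_matrix_mult)

lemma bounded_linear_transpose: "bounded_linear (transpose :: real^'m^'n \<Rightarrow> real^'n^'m)"
  unfolding linear_conv_bounded_linear[symmetric]
  by (rule linearI) (simp_all add: transpose_def vec_eq_iff)

lemma bounded_linear_trace: "bounded_linear (trace :: real^'n^'n \<Rightarrow> real)"
  unfolding linear_conv_bounded_linear[symmetric]
  by (rule linearI) (simp_all add: trace_def sum.distrib sum_distrib_left)

lemma bounded_linear_entry: "bounded_linear (\<lambda>A :: real^'m^'n. A $ i $ j)"
  by (intro bounded_linear_compose[OF bounded_linear_vec_nth] bounded_linear_vec_nth)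

section \<open>Curves on an interval and the fundamental lemma of the calculus of variations\<close>

lemma at_within_interval_neq_bot:
  fixes t :: real
  assumes "is_interval I" "t1 \<in> I" "t2 \<in> I" "t1 \<noteq> t2" "t \<in> I"
  shows "at t within I \<noteq> bot"
proof -
  have "I \<noteq> {x}" for x
    using assms(2-4) by blast
  then show ?thesis
    using connected_imp_perfect[OF is_interval_connected[OF assms(1)] assms(5)]
    unfolding trivial_limit_within by blast
qed

text \<open>For each order, smoothness provides some derivative. In a nondegenerate interval derivatives are
  unique, so all orders share one velocity, which is therefore smooth.\<close>
lemma smooth_curve_derivative:
  fixes c :: "real \<Rightarrow> 'b::real_normed_vector"
  assumes I: "is_interval I" "t1 \<in> I" "t2 \<in> I" "t1 \<noteq> t2" and c: "smooth_on I c"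
  obtains c' where "\<And>t. t \<in> I \<Longrightarrow> (c has_vector_derivative c' t) (at t within I)"
    and "smooth_on I c'"
proof -
  note nt = at_within_interval_neq_bot[OF I]
  have d: "\<exists>d. (\<forall>t\<in>I. (c has_vector_derivative d t) (at t within I)) \<and> Ck_on n d I" for n
  proof -
    have "Ck_on (Suc n) c I"
      using c by (simp only: smooth_on_def)
    then obtain f' where f': "\<forall>x\<in>I. (c has_derivative f' x) (at x within I)"
      "\<forall>i\<in>Basis. Ck_on n (\<lambda>x. f' x i) I"
      by (rule Ck_on_SucE)
    have "(c has_vector_derivative f' t 1) (at t within I)" if "t \<in> I" for t
    proof -
      have "linear (f' t)" using f'(1) that has_derivative_linear by blast
      then have "f' t h = h *\<^sub>R f' t 1" for h
        using linear_scale[of "f' t" h 1] by simp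
      then have "f' t = (\<lambda>h. h *\<^sub>R f' t 1)"
        by (rule ext)
      with bspec[OF f'(1) that] show ?thesis
        unfolding has_vector_derivative_def by (rule has_derivative_eq_rhs)
    qed
    then show ?thesis using f'(2) by (intro exI[of _ "\<lambda>t. f' t 1"]) simp
  qed
  obtain c' where c': "\<forall>t\<in>I. (c has_vector_derivative c' t) (at t within I)"
    using d[of 0] by (elim exE conjE)
  have "Ck_on n c' I" for n
  proof -
    obtain d where d: "\<forall>t\<in>I. (c has_vector_derivative d t) (at t within I)" "Ck_on n d I"
      using d[of n] by (elim exE conjE)
    have "c' t = d t" if "t \<in> I" for t
      using vector_derivative_unique_within[OF nt[OF that] bspec[OF c' that] bspec[OF d(1) that]] .
    with d(2) show ?thesis by (rule Ck_on_cong)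
  qed
  then show thesis using c' by (intro that[of c']) (simp_all add: smooth_on_def)
qed

text \<open>With $c$ the mean value of $f$, the primitive $\varphi$ of $f - c$ that vanishes at $a$ also
  vanishes at $b$, so it is an admissible test function. It gives
  $\int (f - c)^2 = \int \varphi' f - c \int \varphi' = 0$.\<close>
lemma du_Bois_Reymond:
  fixes f :: "real \<Rightarrow> real"
  assumes ab: "a < b" and f: "smooth_on {a..b} f"
    and orth: "\<And>\<phi> \<phi>'. smooth_on {a..b} \<phi> \<Longrightarrow> \<phi> a = 0 \<Longrightarrow> \<phi> b = 0 \<Longrightarrow>
      (\<And>t. t \<in> {a..b} \<Longrightarrow> (\<phi> has_vector_derivative \<phi>' t) (at t within {a..b})) \<Longrightarrow>
      continuous_on {a..b} \<phi>' \<Longrightarrow> integral {a..b} (\<lambda>t. \<phi>' t * f t) = 0"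
  shows "f a = f b"
proof -
  have cf: "continuous_on {a..b} f"
    using f[unfolded smooth_on_def, rule_format, of 0] by simp
  define c where "c = integral {a..b} f / (b - a)"
  define \<phi> where "\<phi> = (\<lambda>t. integral {a..t} f - c * (t - a))"
  have \<phi>': "(\<phi> has_vector_derivative (f t - c)) (at t within {a..b})" if "t \<in> {a..b}" for t
    unfolding \<phi>_def
    by (rule derivative_eq_intros integral_has_vector_derivative[OF cf that] refl | simp)+
  have "Ck_on n (\<lambda>t. f t + - c) {a..b}" for n
    using f unfolding smooth_on_def by (intro Ck_on_add Ck_on_const) blast
  then have "Ck_on (Suc n) \<phi> {a..b}" for n
    using \<phi>' by (intro Ck_on_Suc_real[where f' = "\<lambda>t. f t + - c"]) auto
  then have sm: "smooth_on {a..b} \<phi>"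
    unfolding smooth_on_def using Ck_on_SucD by blast
  have ends: "\<phi> a = 0" "\<phi> b = 0"
    using ab by (auto simp: \<phi>_def c_def)
  have cc: "continuous_on {a..b} (\<lambda>t. f t - c)"
    using cf by (intro continuous_intros)
  have "integral {a..b} (\<lambda>t. (f t - c) * f t) = 0"
    using orth[OF sm ends \<phi>' cc] .
  moreover have "integral {a..b} (\<lambda>t. f t - c) = 0"
    using fundamental_theorem_of_calculus[of a b \<phi> "\<lambda>t. f t - c"] \<phi>' ab ends
    by (auto intro: integral_unique)
  then have "integral {a..b} (\<lambda>t. c * (f t - c)) = 0"
    by simp
  ultimately have "integral {a..b} (\<lambda>t. (f t - c) * f t - c * (f t - c)) = 0"
    using cf by (subst integral_diff)
      (auto intro!: integrable_continuous_interval continuous_intros)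
  then have "integral {a..b} (\<lambda>t. (f t - c)\<^sup>2) = 0"
    by (simp add: power2_eq_square algebra_simps)
  then have "\<forall>t\<in>{a..b}. (f t - c)\<^sup>2 = 0"
    using cf ab by (subst (asm) integral_eq_0_iff) (auto intro!: continuous_intros)
  then show ?thesis using ab by auto
qed

section \<open>One-parameter groups of rotations and of dilations\<close>

text \<open>The conditions characterise $Q(\theta) = e^{\theta J}$ as the solution of $Q' = QJ$, $Q(0) = 1$,
  and put it in $G$.\<close>
definition one_parameter_group ::
    "(real^'n^'n) set \<Rightarrow> (real \<Rightarrow> real^'n^'n) \<Rightarrow> real^'n^'n \<Rightarrow> bool" where
  "one_parameter_group G Q J \<longleftrightarrow> Q 0 = mat 1 \<and>
     (\<forall>\<theta>. Q \<theta> \<in> G \<and> Q \<theta> ** J = J ** Q \<theta> \<and>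
       (Q has_vector_derivative Q \<theta> ** J) (at \<theta>))"

text \<open>Since $Q' = QJ$, each derivative of $Q \circ h$ is an expression in $Q \circ h$ and the derivatives
  of $h$, and the order of differentiability of $h$ is inherited.\<close>
lemma Ck_on_one_parameter_group:
  assumes Q: "one_parameter_group G Q J" and "Ck_on n h S"
  shows "Ck_on n (\<lambda>x. Q (h x)) S"
  using assms(2)
proof (induction n)
  case 0
  have "continuous_on UNIV Q"
    using Q by (auto simp: one_parameter_group_def continuous_on_eq_continuous_at
        intro: has_vector_derivative_continuous)
  then show ?case using 0 continuous_on_compose2[of UNIV Q S h] by simp
next
  case (Suc n)
  obtain h' where h': "\<forall>x\<in>S. (h has_derivative h' x) (at x within S)"
    "\<forall>i\<in>Basis. Ck_on n (\<lambda>x. h' x i) S"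
    using Suc.prems by (rule Ck_on_SucE)
  let ?d = "\<lambda>x v. h' x v *\<^sub>R (Q (h x) ** J)"
  have "\<forall>x\<in>S. ((\<lambda>x. Q (h x)) has_derivative ?d x) (at x within S)"
  proof
    fix x assume "x \<in> S"
    moreover have "(Q has_derivative (\<lambda>r. r *\<^sub>R (Q (h x) ** J))) (at (h x))"
      using Q unfolding one_parameter_group_def has_vector_derivative_def by blast
    ultimately show "((\<lambda>x. Q (h x)) has_derivative ?d x) (at x within S)"
      using h'(1) by (intro has_derivative_compose[of h _ x S Q]) simp_all
  qed
  moreover have "\<forall>i\<in>Basis. Ck_on n (\<lambda>x. ?d x i) S"
    using h'(2) Suc.IH[OF Ck_on_SucD[OF Suc.prems]]
    by (intro ballI Ck_on_bounded_bilinear[OF bounded_bilinear_scaleR]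
        Ck_on_bounded_linear[OF matrix_mult.bounded_linear_left]) simp_all
  ultimately show ?case by (rule Ck_on_SucI)
qed

definition matrix_unit :: "'n \<Rightarrow> 'n \<Rightarrow> real^'n^'n" where
  "matrix_unit i j = (\<chi> a b. if a = i \<and> b = j then 1 else 0)"

lemma matrix_unit_mult:
  "matrix_unit i j ** matrix_unit k l = (if j = k then matrix_unit i l else 0)"
proof -
  have "(\<Sum>c\<in>UNIV. (if a = i \<and> c = j then 1 else 0) * (if c = k \<and> b = l then 1 else 0)) =
      (if a = i \<and> b = l \<and> j = k then 1 else (0::real))" for a b
  proof -
    have "(\<Sum>c\<in>UNIV. (if a = i \<and> c = j then 1 else 0) * (if c = k \<and> b = l then 1 else 0)) =
      (\<Sum>c\<in>UNIV. if c = j then (if a = i \<and> b = l \<and> j = k then 1 else (0::real)) else 0)"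
      by (intro sum.cong) auto
    then show ?thesis by simp
  qed
  then show ?thesis
    by (auto simp: matrix_unit_def matrix_matrix_mult_def vec_eq_iff)
qed

lemma trace_mult_matrix_unit: "trace (A ** matrix_unit i j) = A $ j $ i"
proof -
  have "(\<Sum>b\<in>UNIV. A $ a $ b * matrix_unit i j $ b $ a) = (if a = j then A $ j $ i else 0)" for a
  proof -
    have "(\<Sum>b\<in>UNIV. A $ a $ b * matrix_unit i j $ b $ a) =
        (\<Sum>b\<in>UNIV. if b = i then (if a = j then A $ j $ i else 0) else 0)"
      by (intro sum.cong) (auto simp: matrix_unit_def)
    then show ?thesis by simp
  qed
  then show ?thesis
    by (simp add: trace_def matrix_matrix_mult_def)
qed

lemma transpose_matrix_unit: "transpose (matrix_unit i j) = matrix_unit j i"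
  by (auto simp: transpose_def matrix_unit_def vec_eq_iff)

lemma matrix_inv_unique:
  fixes A B :: "real^'n^'n"
  assumes "A ** B = mat 1"
  shows "matrix_inv B = A"
proof -
  have BA: "B ** A = mat 1"
    using assms matrix_left_right_inverse by blast
  have "B ** matrix_inv B = mat 1 \<and> matrix_inv B ** B = mat 1"
    unfolding matrix_inv_def by (rule someI[of _ A]) (simp add: assms BA)
  then have "A ** (B ** matrix_inv B) = A"
    by simp
  then show ?thesis
    by (simp add: matrix_mul_assoc assms)
qed

lemma matrix_inv_Diag_pos:
  assumes "D \<in> Diag_pos"
  shows "matrix_inv D = (\<Sum>i\<in>UNIV. inverse (D $ i $ i) *\<^sub>R matrix_unit i i)"
    and "matrix_inv D ** D = mat 1"
proof -
  let ?N = "\<Sum>i\<in>UNIV. inverse (D $ i $ i) *\<^sub>R matrix_unit i i"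
  have entry: "?N $ a $ b = (if a = b then inverse (D $ a $ a) else 0)" for a b
  proof -
    have "?N $ a $ b = (\<Sum>i\<in>UNIV. if i = a then (if a = b then inverse (D $ a $ a) else 0) else 0)"
      unfolding sum_component by (intro sum.cong) (auto simp: matrix_unit_def)
    then show ?thesis by simp
  qed
  have D: "D $ a $ b = (if a = b then D $ a $ a else 0)" "D $ a $ a \<noteq> 0" for a b
    using assms order.strict_implies_not_eq[of 0 "D $ a $ a"] by (auto simp: Diag_pos_def)
  have "(\<Sum>c\<in>UNIV. ?N $ a $ c * D $ c $ b) = (if a = b then 1 else 0)" for a b
  proof -
    have "(\<Sum>c\<in>UNIV. ?N $ a $ c * D $ c $ b) =
        (\<Sum>c\<in>UNIV. if c = a then inverse (D $ a $ a) * D $ a $ b else 0)"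
      by (intro sum.cong refl) (simp only: entry, simp)
    then show ?thesis using assms D(2)[of a] by (auto simp: Diag_pos_def)
  qed
  then have "?N ** D = mat 1"
    by (simp only: matrix_matrix_mult_def mat_def vec_eq_iff vec_lambda_beta) simp
  then show "matrix_inv D = ?N"
    by (rule matrix_inv_unique)
  with \<open>?N ** D = mat 1\<close> show "matrix_inv D ** D = mat 1" by simp
qed

lemma one_parameter_group_trivial: "mat 1 \<in> G \<Longrightarrow> one_parameter_group G (\<lambda>\<theta>. mat 1) 0"
  by (simp add: one_parameter_group_def matrix_mult.zero_left matrix_mult.zero_right)

lemma mat_1_in_SO: "mat 1 \<in> SO"
  by (simp add: SO_def rotation_matrix_def orthogonal_matrix_def)

lemma mat_1_in_Diag_pos: "mat 1 \<in> Diag_pos"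
  by (simp add: Diag_pos_def mat_def)

text \<open>Here $J^3 = -J$ with $-J^2 = P$ the projection to the coordinate plane of $i$ and $j$, so
  that $e^{\theta J} = 1 + (\cos\theta - 1) P + \sin\theta \, J$ (Rodrigues' formula).\<close>
lemma one_parameter_group_plane_rotation:
  fixes i j :: "'n::finite"
  assumes "i \<noteq> j"
  defines "J \<equiv> matrix_unit i j - matrix_unit j i" and "P \<equiv> matrix_unit i i + matrix_unit j j"
  shows "one_parameter_group SO (\<lambda>\<theta>. mat 1 + (cos \<theta> - 1) *\<^sub>R P + sin \<theta> *\<^sub>R J) J"
proof -
  define Q where "Q = (\<lambda>\<theta>. mat 1 + (cos \<theta> - 1) *\<^sub>R P + sin \<theta> *\<^sub>R J)"
  have JJ: "J ** J = - P" and JP: "J ** P = J" and PJ: "P ** J = J" and PP: "P ** P = P"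
    using assms(1)
    by (simp_all add: J_def P_def matrix_unit_mult matrix_mult.add_left matrix_mult.add_right
        matrix_mult.diff_left matrix_mult.diff_right)
  have tr: "transpose (A + B) = transpose A + transpose B"
    "transpose (A - B) = transpose A - transpose B" for A B :: "real^'n^'n"
    by (simp_all add: transpose_def vec_eq_iff)
  have tJ: "transpose J = - J" and tP: "transpose P = P"
    by (simp_all add: J_def P_def tr transpose_matrix_unit)
  note expand = matrix_mult.add_left matrix_mult.add_right matrix_mult.diff_left
    matrix_mult.diff_right matrix_mult.scaleR_left
    matrix_mult.scaleR_right JJ JP PJ PP
  have mult: "Q \<alpha> ** Q \<beta> = Q (\<alpha> + \<beta>)" for \<alpha> \<beta>
    by (simp add: Q_def expand cos_add sin_add algebra_simps)
  have Q0: "Q 0 = mat 1" by (simp add: Q_def)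
  have "transpose (Q \<theta>) = Q (- \<theta>)" for \<theta>
    by (simp add: Q_def tr transpose_scalar tJ tP)
  then have orth: "orthogonal_matrix (Q \<theta>)" for \<theta>
    by (simp add: orthogonal_matrix_def mult Q0)
  \<comment> \<open>A square has nonnegative determinant, which excludes the value -1.\<close>
  have "det (Q \<theta>) = 1" for \<theta>
  proof -
    have "det (Q \<theta>) = det (Q (\<theta> / 2)) * det (Q (\<theta> / 2))"
      using mult[of "\<theta> / 2" "\<theta> / 2"] by (simp flip: det_mul)
    then show ?thesis
      using det_orthogonal_matrix[OF orth[of "\<theta> / 2"]] by auto
  qed
  with orth have "Q \<theta> \<in> SO" for \<theta>
    by (simp add: SO_def rotation_matrix_def)
  moreover have "Q \<theta> ** J = J ** Q \<theta>" for \<theta>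
    by (simp add: Q_def expand)
  moreover have "(Q has_vector_derivative Q \<theta> ** J) (at \<theta>)" for \<theta>
  proof -
    have "(Q has_vector_derivative (- sin \<theta>) *\<^sub>R P + cos \<theta> *\<^sub>R J) (at \<theta>)"
      unfolding Q_def has_vector_derivative_def
      by (auto intro!: derivative_eq_intros simp: algebra_simps)
    moreover have "Q \<theta> ** J = (- sin \<theta>) *\<^sub>R P + cos \<theta> *\<^sub>R J"
      by (simp add: Q_def expand algebra_simps)
    ultimately show ?thesis by simp
  qed
  ultimately have "one_parameter_group SO Q J"
    using Q0 by (simp add: one_parameter_group_def)
  then show ?thesis by (simp add: Q_def)
qed

lemma one_parameter_group_dilation:
  "one_parameter_group Diag_pos (\<lambda>\<theta>. mat 1 + (exp \<theta> - 1) *\<^sub>R matrix_unit i i) (matrix_unit i i)"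
proof -
  define Q where "Q = (\<lambda>\<theta>. mat 1 + (exp \<theta> - 1) *\<^sub>R matrix_unit i i)"
  have "Q \<theta> \<in> Diag_pos" for \<theta>
    by (auto simp: Q_def Diag_pos_def mat_def matrix_unit_def)
  moreover have QJ: "Q \<theta> ** matrix_unit i i = exp \<theta> *\<^sub>R matrix_unit i i"
    "matrix_unit i i ** Q \<theta> = exp \<theta> *\<^sub>R matrix_unit i i" for \<theta>
    by (simp_all add: Q_def matrix_mult.add_left matrix_mult.add_right matrix_mult.scaleR_left
        matrix_mult.diff_left matrix_mult.diff_right
        matrix_mult.scaleR_right matrix_unit_mult algebra_simps)
  moreover have "(Q has_vector_derivative exp \<theta> *\<^sub>R matrix_unit i i) (at \<theta>)" for \<theta>
    unfolding Q_def has_vector_derivative_def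
    by (auto intro!: derivative_eq_intros simp: algebra_simps)
  moreover have "Q 0 = mat 1" by (simp add: Q_def)
  ultimately have "one_parameter_group Diag_pos Q (matrix_unit i i)"
    by (simp add: one_parameter_group_def)
  then show ?thesis by (simp add: Q_def)
qed

section \<open>Invariance of the metric under right translation\<close>

lemma SO_mult: "A \<in> SO \<Longrightarrow> B \<in> SO \<Longrightarrow> A ** B \<in> SO"
  by (simp add: SO_def rotation_matrix_def orthogonal_matrix_mul det_mul)

lemma Diag_pos_mult_entry:
  assumes "D \<in> Diag_pos"
  shows "(D ** A) $ i $ j = D $ i $ i * A $ i $ j"
    and "(A ** D) $ i $ j = A $ i $ j * D $ j $ j"
proof -
  have "(\<Sum>c\<in>UNIV. D $ i $ c * A $ c $ j) = (\<Sum>c\<in>UNIV. if c = i then D $ i $ i * A $ i $ j else 0)"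
    using assms by (intro sum.cong refl) (auto simp: Diag_pos_def)
  moreover have "(\<Sum>c\<in>UNIV. A $ i $ c * D $ c $ j) = (\<Sum>c\<in>UNIV. if c = j then A $ i $ j * D $ j $ j else 0)"
    using assms by (intro sum.cong refl) (auto simp: Diag_pos_def)
  ultimately show "(D ** A) $ i $ j = D $ i $ i * A $ i $ j"
    "(A ** D) $ i $ j = A $ i $ j * D $ j $ j"
    by (simp_all add: matrix_matrix_mult_def)
qed

lemma Diag_pos_mult: "A \<in> Diag_pos \<Longrightarrow> B \<in> Diag_pos \<Longrightarrow> A ** B \<in> Diag_pos"
  using Diag_pos_mult_entry(1)[of A B] by (simp add: Diag_pos_def)

text \<open>Right translation by $Q = e^{\theta J}$ conjugates the left logarithmic derivative: if
  $\theta' = c$ and $(VQ)' = W$ then $(VQ)^{-1} W = Q^{-1} (V^{-1}V' + cJ) Q$, and the trace of the square does not see the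
  conjugation. Both $g_{SO}$ and the metric on the diagonal matrices are traces of this form.\<close>
lemma trace_square_translate:
  fixes V V' V\<^sub>i Q Q\<^sub>i J :: "real^'n^'n"
  assumes V: "V\<^sub>i ** V = mat 1" and Q: "Q\<^sub>i ** Q = mat 1" and J: "Q ** J = J ** Q"
    and W: "W = V ** (c *\<^sub>R (Q ** J)) + V' ** Q" and Y: "Y = V\<^sub>i ** V' + c *\<^sub>R J"
  shows "trace ((Q\<^sub>i ** V\<^sub>i ** W) ** (Q\<^sub>i ** V\<^sub>i ** W)) = trace (Y ** Y)"
proof -
  have Q': "Q ** Q\<^sub>i = mat 1"
    using Q matrix_left_right_inverse by blast
  have "V\<^sub>i ** W = Y ** Q"
    unfolding W Y matrix_mult.add_left matrix_mult.add_right matrix_mult.scaleR_left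
      matrix_mult.scaleR_right J
    by (simp add: matrix_mul_assoc V)
  then have "Q\<^sub>i ** V\<^sub>i ** W = Q\<^sub>i ** (Y ** Q)"
    by (simp flip: matrix_mul_assoc)
  then have "trace ((Q\<^sub>i ** V\<^sub>i ** W) ** (Q\<^sub>i ** V\<^sub>i ** W)) = trace (Q\<^sub>i ** (Y ** (Q ** Q\<^sub>i) ** Y ** Q))"
    by (simp add: matrix_mul_assoc)
  also have "\<dots> = trace ((Y ** Y ** Q) ** Q\<^sub>i)"
    unfolding Q' by (simp add: trace_mul_sym[of Q\<^sub>i])
  also have "\<dots> = trace (Y ** Y)"
    by (simp add: Q' flip: matrix_mul_assoc)
  finally show ?thesis .
qed

lemma g_M_translate:
  fixes U U' D D' R E J L X \<Lambda> :: "real^'n^'n" and c k :: real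
  assumes "U \<in> SO" "D \<in> Diag_pos" "R \<in> SO" "E \<in> Diag_pos" "R ** J = J ** R" "E ** L = L ** E"
    and X: "X = transpose U ** U'" and \<Lambda>: "\<Lambda> = matrix_inv D ** D'"
  defines "W \<equiv> (U ** (c *\<^sub>R (R ** J)) + U' ** R, D ** (c *\<^sub>R (E ** L)) + D' ** E)"
  shows "g_M k (U ** R, D ** E) W W =
    - k / 2 * trace ((X + c *\<^sub>R J) ** (X + c *\<^sub>R J)) +
    trace ((\<Lambda> + c *\<^sub>R L) ** (\<Lambda> + c *\<^sub>R L))"
proof -
  have orth: "transpose U ** U = mat 1" "transpose R ** R = mat 1"
    using assms by (auto simp: SO_def rotation_matrix_def orthogonal_matrix_def)
  have DE: "matrix_inv D ** D = mat 1" "matrix_inv E ** E = mat 1"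
    using assms matrix_inv_Diag_pos by blast+
  have "matrix_inv E ** matrix_inv D ** (D ** E) = matrix_inv E ** (matrix_inv D ** D) ** E"
    by (simp add: matrix_mul_assoc)
  then have "matrix_inv E ** matrix_inv D ** (D ** E) = mat 1"
    by (simp add: DE)
  then have inv: "matrix_inv (D ** E) = matrix_inv E ** matrix_inv D"
    by (rule matrix_inv_unique)
  show ?thesis
    unfolding W_def g_M_def g_SO_def g_Diag_def X \<Lambda> prod.case inv
      matrix_transpose_mul
    using trace_square_translate[OF orth assms(5) refl refl, of c U']
      trace_square_translate[OF DE assms(6) refl refl, of c D']
    by (simp add: matrix_mul_assoc)
qed

section \<open>Conserved momenta of geodesics\<close>

lemma Ck_on_matrix_inv_Diag_pos:
  assumes "Ck_on n D S" and "\<And>x. x \<in> S \<Longrightarrow> D x \<in> Diag_pos"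
  shows "Ck_on n (\<lambda>x. matrix_inv (D x)) S"
proof -
  have sum: "Ck_on n (\<lambda>x. \<Sum>i\<in>A. f i x) S"
    if "finite A" "\<And>i. Ck_on n (f i) S" for A :: "'b set" and f :: "'b \<Rightarrow> 'a \<Rightarrow> real^'b^'b"
    using that by (induction rule: finite_induct) (simp_all add: Ck_on_const Ck_on_add)
  have "D x $ i $ i \<noteq> 0" if "x \<in> S" for x i
    using assms(2)[OF that] less_imp_neq[of 0 "D x $ i $ i"] by (auto simp: Diag_pos_def)
  then have "Ck_on n (\<lambda>x. inverse (D x $ i $ i) *\<^sub>R matrix_unit i i) S" for i
    using assms(1)
    by (intro Ck_on_bounded_bilinear[OF bounded_bilinear_scaleR] Ck_on_inverse Ck_on_const
        Ck_on_bounded_linear[OF bounded_linear_entry])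
  then have "Ck_on n (\<lambda>x. \<Sum>i\<in>UNIV. inverse (D x $ i $ i) *\<^sub>R matrix_unit i i) S"
    by (intro sum) simp_all
  then show ?thesis
    by (rule Ck_on_cong) (simp add: matrix_inv_Diag_pos(1) assms(2))
qed

text \<open>The variation moves the point at time $t$ along the orbits of the two one-parameter groups by the
  amount $s \varphi(t)$. As the metric is invariant, the moved curve has logarithmic derivatives
  $X + s\varphi'J$ and $\Lambda + s\varphi'L$ up to conjugation, so the energy is exactly quadratic
  in $s$. Its linear coefficient, which has to vanish, is the integral in the conclusion.\<close>
lemma first_variation:
  fixes U D U' D' :: "real \<Rightarrow> real^'p^'p"
  assumes geo: "geodesic_on M (g_M k) I (\<lambda>t. (U t, D t))"
    and ab: "a < b" "{a..b} \<subseteq> I"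
    and sm: "smooth_on I U" "smooth_on I D"
    and U': "\<And>t. t \<in> I \<Longrightarrow> (U has_vector_derivative U' t) (at t within I)"
    and D': "\<And>t. t \<in> I \<Longrightarrow> (D has_vector_derivative D' t) (at t within I)"
    and R: "one_parameter_group SO R J" and E: "one_parameter_group Diag_pos E L"
    and \<phi>: "smooth_on {a..b} \<phi>" "\<phi> a = 0" "\<phi> b = 0"
    and \<phi>': "\<And>t. t \<in> {a..b} \<Longrightarrow> (\<phi> has_vector_derivative \<phi>' t) (at t within {a..b})"
    and c\<phi>': "continuous_on {a..b} \<phi>'"
    and cX: "continuous_on {a..b} X" and c\<Lambda>: "continuous_on {a..b} \<Lambda>"
    and X: "\<And>t. X t = transpose (U t) ** U' t" and \<Lambda>: "\<And>t. \<Lambda> t = matrix_inv (D t) ** D' t"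
  shows "integral {a..b} (\<lambda>t. \<phi>' t * (- k / 2 * trace (X t ** J) + trace (\<Lambda> t ** L))) = 0"
proof -
  define \<Gamma> where "\<Gamma> = (\<lambda>(s, t). (U t ** R (s * \<phi> t), D t ** E (s * \<phi> t)))"
  have UD: "U t \<in> SO" "D t \<in> Diag_pos" if "t \<in> {a..b}" for t
    using geo ab that unfolding geodesic_on_def M_def by blast+
  have Rg: "R 0 = mat 1" "R \<theta> \<in> SO" "R \<theta> ** J = J ** R \<theta>"
      "(R has_vector_derivative R \<theta> ** J) (at \<theta>)"
    and Eg: "E 0 = mat 1" "E \<theta> \<in> Diag_pos" "E \<theta> ** L = L ** E \<theta>"
      "(E has_vector_derivative E \<theta> ** L) (at \<theta>)" for \<theta>
    using R E unfolding one_parameter_group_def by blast+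
  have "Ck_on n \<Gamma> ({-1<..<1} \<times> {a..b})" for n
  proof -
    have "Ck_on n \<phi> {a..b}" "Ck_on n U {a..b}" "Ck_on n D {a..b}"
      using \<phi>(1) sm ab(2) Ck_on_subset unfolding smooth_on_def by blast+
    then have "Ck_on n (\<lambda>x. (U (snd x) ** R (fst x * \<phi> (snd x)), D (snd x) ** E (fst x * \<phi> (snd x))))
        ({-1<..<1} \<times> {a..b})"
      by (intro Ck_on_Pair Ck_on_bounded_bilinear[OF bounded_bilinear_matrix_mult]
          Ck_on_one_parameter_group[OF R] Ck_on_one_parameter_group[OF E]
          Ck_on_bounded_bilinear[OF bounded_bilinear_mult] Ck_on_fst Ck_on_compose_snd)
    then show ?thesis by (simp add: \<Gamma>_def case_prod_unfold)
  qed
  \<comment> \<open>The groups are defined for all parameters, so the half-width 1 is arbitrary.\<close>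
  then have "proper_variation M a b (\<lambda>t. (U t, D t)) 1 \<Gamma>"
    using UD \<phi>(2,3) Rg(1,2) Eg(1,2)
    by (auto simp: proper_variation_def smooth_on_def M_def \<Gamma>_def SO_mult Diag_pos_mult)
  then have crit: "((\<lambda>s. energy (g_M k) a b (\<lambda>t. \<Gamma> (s, t))) has_real_derivative 0) (at 0)"
    using geo ab unfolding geodesic_on_def by blast
  define q\<^sub>0 where "q\<^sub>0 = (\<lambda>t. - k / 2 * trace (X t ** X t) + trace (\<Lambda> t ** \<Lambda> t))"
  define q\<^sub>1 where "q\<^sub>1 = (\<lambda>t. \<phi>' t * (- k / 2 * trace (X t ** J) + trace (\<Lambda> t ** L)))"
  define q\<^sub>2 where "q\<^sub>2 = (\<lambda>t. (\<phi>' t)\<^sup>2 * (- k / 2 * trace (J ** J) + trace (L ** L)))"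
  have cont: "continuous_on {a..b} q\<^sub>0" "continuous_on {a..b} q\<^sub>1" "continuous_on {a..b} q\<^sub>2"
    unfolding q\<^sub>0_def q\<^sub>1_def q\<^sub>2_def
    by (intro continuous_intros bounded_linear.continuous_on[OF bounded_linear_trace]
        matrix_mult.continuous_on cX c\<Lambda> c\<phi>')+
  have energy: "energy (g_M k) a b (\<lambda>t. \<Gamma> (s, t)) =
      1 / 2 * (integral {a..b} q\<^sub>0 + 2 * s * integral {a..b} q\<^sub>1 + s\<^sup>2 * integral {a..b} q\<^sub>2)" for s
  proof -
    have integrand: "g_M k (\<Gamma> (s, t)) (vector_derivative (\<lambda>t. \<Gamma> (s, t)) (at t within {a..b}))
        (vector_derivative (\<lambda>t. \<Gamma> (s, t)) (at t within {a..b})) = q\<^sub>0 t + 2 * s * q\<^sub>1 t + s\<^sup>2 * q\<^sub>2 t"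
      if t: "t \<in> {a..b}" for t
    proof -
      have s\<phi>: "((\<lambda>t. s * \<phi> t) has_vector_derivative s * \<phi>' t) (at t within {a..b})"
        using \<phi>'[OF t] by (rule has_vector_derivative_mult_right)
      have dR: "((\<lambda>t. R (s * \<phi> t)) has_vector_derivative (s * \<phi>' t) *\<^sub>R (R (s * \<phi> t) ** J))
          (at t within {a..b})"
        using vector_diff_chain_within[OF s\<phi>, of R] has_vector_derivative_at_within[OF Rg(4)]
        by (simp add: comp_def)
      have dE: "((\<lambda>t. E (s * \<phi> t)) has_vector_derivative (s * \<phi>' t) *\<^sub>R (E (s * \<phi> t) ** L))
          (at t within {a..b})"
        using vector_diff_chain_within[OF s\<phi>, of E] has_vector_derivative_at_within[OF Eg(4)]
        by (simp add: comp_def)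
      let ?W = "(U t ** ((s * \<phi>' t) *\<^sub>R (R (s * \<phi> t) ** J)) + U' t ** R (s * \<phi> t),
          D t ** ((s * \<phi>' t) *\<^sub>R (E (s * \<phi> t) ** L)) + D' t ** E (s * \<phi> t))"
      have dU: "(U has_vector_derivative U' t) (at t within {a..b})"
        and dD: "(D has_vector_derivative D' t) (at t within {a..b})"
        using U' D' t ab(2) has_vector_derivative_within_subset by blast+
      have "((\<lambda>t. \<Gamma> (s, t)) has_vector_derivative ?W) (at t within {a..b})"
        unfolding \<Gamma>_def prod.case
        by (intro has_vector_derivative_Pair matrix_mult.has_vector_derivative dU dD dR dE)
      then have W: "vector_derivative (\<lambda>t. \<Gamma> (s, t)) (at t within {a..b}) = ?W"
        using vector_derivative_within_closed_interval ab(1) t by blast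
      have sq: "trace ((A + c *\<^sub>R B) ** (A + c *\<^sub>R B)) =
          trace (A ** A) + 2 * c * trace (A ** B) + c\<^sup>2 * trace (B ** B)"
        for A B :: "real^'p^'p" and c
        by (simp add: matrix_mult.add_left matrix_mult.add_right matrix_mult.scaleR_left
            matrix_mult.scaleR_right trace_add linear_scale[OF bounded_linear.linear[OF bounded_linear_trace]]
            trace_mul_sym[of B A] power2_eq_square algebra_simps)
      have "g_M k (\<Gamma> (s, t)) ?W ?W =
          - k / 2 * trace ((X t + (s * \<phi>' t) *\<^sub>R J) ** (X t + (s * \<phi>' t) *\<^sub>R J)) +
          trace ((\<Lambda> t + (s * \<phi>' t) *\<^sub>R L) ** (\<Lambda> t + (s * \<phi>' t) *\<^sub>R L))"
        unfolding \<Gamma>_def prod.case using UD[OF t] Rg(2,3) Eg(2,3) X \<Lambda>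
        by (intro g_M_translate) simp_all
      then show ?thesis
        unfolding W sq q\<^sub>0_def q\<^sub>1_def q\<^sub>2_def by (simp add: field_simps power2_eq_square)
    qed
    have "energy (g_M k) a b (\<lambda>t. \<Gamma> (s, t)) =
        1 / 2 * integral {a..b} (\<lambda>t. q\<^sub>0 t + 2 * s * q\<^sub>1 t + s\<^sup>2 * q\<^sub>2 t)"
      unfolding energy_def
      by (intro arg_cong[where f = "(*) (1 / 2)"] integral_cong integrand)
    also have "integral {a..b} (\<lambda>t. q\<^sub>0 t + 2 * s * q\<^sub>1 t + s\<^sup>2 * q\<^sub>2 t) =
        integral {a..b} q\<^sub>0 + 2 * s * integral {a..b} q\<^sub>1 + s\<^sup>2 * integral {a..b} q\<^sub>2"
      using cont[THEN integrable_continuous_interval]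
      by (intro integral_unique has_integral_add has_integral_mult_right integrable_integral)
    finally show ?thesis .
  qed
  have "((\<lambda>s. energy (g_M k) a b (\<lambda>t. \<Gamma> (s, t))) has_real_derivative integral {a..b} q\<^sub>1) (at 0)"
    unfolding energy by (auto intro!: derivative_eq_intros)
  then have "integral {a..b} q\<^sub>1 = 0"
    using crit DERIV_unique by blast
  then show ?thesis unfolding q\<^sub>1_def .
qed

text \<open>This is Noether's theorem for the isometries given by right translation. The function $p$ is
  orthogonal to all derivatives of test functions, hence constant.\<close>
lemma conserved_momentum:
  fixes U D U' D' :: "real \<Rightarrow> real^'p^'p"
  assumes geo: "geodesic_on M (g_M k) I (\<lambda>t. (U t, D t))"
    and I: "is_interval I" and t: "t1 \<in> I" "t2 \<in> I"
    and sm: "smooth_on I U" "smooth_on I D" "smooth_on I U'" "smooth_on I D'"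
    and U': "\<And>t. t \<in> I \<Longrightarrow> (U has_vector_derivative U' t) (at t within I)"
    and D': "\<And>t. t \<in> I \<Longrightarrow> (D has_vector_derivative D' t) (at t within I)"
    and R: "one_parameter_group SO R J" and E: "one_parameter_group Diag_pos E L"
  defines "p \<equiv> \<lambda>t. - k / 2 * trace (transpose (U t) ** U' t ** J) +
      trace (matrix_inv (D t) ** D' t ** L)"
  shows "p t1 = p t2"
proof -
  have DI: "D t \<in> Diag_pos" if "t \<in> I" for t
    using geo that unfolding geodesic_on_def M_def by blast
  have C: "Ck_on n (\<lambda>t. transpose (U t) ** U' t) I" "Ck_on n (\<lambda>t. matrix_inv (D t) ** D' t) I" for n
    using sm DI unfolding smooth_on_def
    by (intro Ck_on_bounded_bilinear[OF bounded_bilinear_matrix_mult] Ck_on_matrix_inv_Diag_pos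
        Ck_on_bounded_linear[OF bounded_linear_transpose]; blast)+
  have p: "Ck_on n p I" for n
    unfolding p_def using C
    by (intro Ck_on_add Ck_on_bounded_linear[OF bounded_linear_mult_right]
        Ck_on_bounded_linear[OF bounded_linear_trace]
        Ck_on_bounded_linear[OF matrix_mult.bounded_linear_left])
  have step: "p a = p b" if ab: "a < b" "a \<in> I" "b \<in> I" for a b
  proof (rule du_Bois_Reymond[of a b p])
    show "a < b" by fact
    have sub: "{a..b} \<subseteq> I"
      using mem_is_interval_1_I[OF I ab(2,3)] by auto
    show "smooth_on {a..b} p"
      unfolding smooth_on_def using Ck_on_subset[OF p sub] by simp
    fix \<phi> \<phi>' :: "real \<Rightarrow> real"
    assume \<phi>: "smooth_on {a..b} \<phi>" "\<phi> a = 0" "\<phi> b = 0"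
      "\<And>t. t \<in> {a..b} \<Longrightarrow> (\<phi> has_vector_derivative \<phi>' t) (at t within {a..b})"
      "continuous_on {a..b} \<phi>'"
    have "continuous_on {a..b} (\<lambda>t. transpose (U t) ** U' t)"
      "continuous_on {a..b} (\<lambda>t. matrix_inv (D t) ** D' t)"
      using C[of 0] sub by (auto intro: continuous_on_subset)
    then show "integral {a..b} (\<lambda>t. \<phi>' t * p t) = 0"
      unfolding p_def
      by (intro first_variation[OF geo ab(1) sub sm(1,2) U' D' R E \<phi>]) simp_all
  qed
  then show ?thesis
    using t by (metis linorder_less_linear)
qed

section \<open>Composition of geodesics with the map F\<close>

lemma F_in_Sym_pos:
  assumes "U \<in> SO" and "D \<in> Diag_pos"
  shows "F (U, D) \<in> Sym_pos"
proof -
  have "transpose D = D"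
    using assms(2) unfolding transpose_def vec_eq_iff Diag_pos_def
    by (simp, metis)
  then have "transpose (F (U, D)) = F (U, D)"
    by (simp add: F_def matrix_transpose_mul matrix_mul_assoc)
  moreover have "x \<bullet> (F (U, D) *v x) > 0" if "x \<noteq> 0" for x
  proof -
    define y where "y = transpose U *v x"
    have "U *v y = x"
      using assms(1) unfolding y_def matrix_vector_mul_assoc
      by (simp add: SO_def rotation_matrix_def orthogonal_matrix_def)
    with that have "y \<noteq> 0" by auto
    then obtain i where i: "y $ i \<noteq> 0" by (auto simp: vec_eq_iff)
    have Dy: "(D *v y) $ a = D $ a $ a * y $ a" for a
    proof -
      have "(\<Sum>c\<in>UNIV. D $ a $ c * y $ c) = (\<Sum>c\<in>UNIV. if c = a then D $ a $ a * y $ a else 0)"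
        using assms(2) by (intro sum.cong refl) (auto simp: Diag_pos_def)
      then show ?thesis by (simp add: matrix_vector_mult_def)
    qed
    have "x \<bullet> (F (U, D) *v x) = x \<bullet> (U *v (D *v y))"
      by (simp add: F_def y_def matrix_vector_mul_assoc matrix_mul_assoc del: transpose_matrix_vector)
    also have "\<dots> = y \<bullet> (D *v y)"
      by (simp add: y_def dot_lmul_matrix)
    also have "\<dots> = (\<Sum>a\<in>UNIV. D $ a $ a * (y $ a)\<^sup>2)"
      by (simp add: inner_vec_def Dy power2_eq_square mult.left_commute)
    also have "\<dots> > 0"
      using assms(2) i by (intro sum_pos2[of _ i]) (auto simp: Diag_pos_def less_imp_le)
    finally show ?thesis .
  qed
  ultimately show ?thesis by (simp add: Sym_pos_def)
qed

theorem proposition3p8: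
  fixes k :: real
    and I :: "real set"
    and \<gamma> :: "real \<Rightarrow> (real^'p^'p) \<times> (real^'p^'p)"
  assumes "CARD('p) \<ge> 2"
    and "k > 0"
    and "is_interval I"
    and "geodesic_on M (g_M k) I \<gamma>"
    and "\<not> \<gamma> constant_on I"
  shows "(F \<circ> \<gamma>) ` I \<subseteq> Sym_pos \<and>
    (immersion_on I (F \<circ> \<gamma>) \<or> (F \<circ> \<gamma>) constant_on I)"
proof -
  define U where "U = (\<lambda>t. fst (\<gamma> t))"
  define D where "D = (\<lambda>t. snd (\<gamma> t))"
  have \<gamma>: "\<gamma> = (\<lambda>t. (U t, D t))"
    by (simp add: U_def D_def)
  have geo: "geodesic_on M (g_M k) I (\<lambda>t. (U t, D t))"
    using assms(4) by (simp add: \<gamma>)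
  have UI: "U t \<in> SO" and DI: "D t \<in> Diag_pos" if "t \<in> I" for t
    using geo that unfolding geodesic_on_def M_def by blast+
  obtain t1 t2 where t12: "t1 \<in> I" "t2 \<in> I" "t1 \<noteq> t2"
    using assms(5) unfolding constant_on_def by metis
  note I = assms(3) t12
  note nt = at_within_interval_neq_bot[OF I]
  have "smooth_on I \<gamma>"
    using assms(4) by (simp add: geodesic_on_def)
  then have sm: "smooth_on I U" "smooth_on I D"
    unfolding U_def D_def smooth_on_def
    by (simp_all add: Ck_on_bounded_linear[OF bounded_linear_fst]
        Ck_on_bounded_linear[OF bounded_linear_snd])
  obtain U' where U': "\<And>t. t \<in> I \<Longrightarrow> (U has_vector_derivative U' t) (at t within I)"
      "smooth_on I U'"
    using smooth_curve_derivative[OF I sm(1)] by blast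
  obtain D' where D': "\<And>t. t \<in> I \<Longrightarrow> (D has_vector_derivative D' t) (at t within I)"
      "smooth_on I D'"
    using smooth_curve_derivative[OF I sm(2)] by blast
  note dtranspose = bounded_linear.has_vector_derivative[OF bounded_linear_transpose]
  define X where "X = (\<lambda>t. transpose (U t) ** U' t)"
  define \<Lambda> where "\<Lambda> = (\<lambda>t. matrix_inv (D t) ** D' t)"
  have momentum: "- k / 2 * trace (X s ** J) + trace (\<Lambda> s ** L) =
      - k / 2 * trace (X t ** J) + trace (\<Lambda> t ** L)"
    if "s \<in> I" "t \<in> I" "one_parameter_group SO R J" "one_parameter_group Diag_pos E L"
    for s t R J E L
    unfolding X_def \<Lambda>_def
    by (rule conserved_momentum[OF geo assms(3) that(1,2) sm U'(2) D'(2) U'(1) D'(1) that(3,4)])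
  have orth: "transpose (U t) ** U t = mat 1" "U t ** transpose (U t) = mat 1" if "t \<in> I" for t
    using UI[OF that] by (simp_all add: SO_def rotation_matrix_def orthogonal_matrix_def)
  have skew: "transpose (X t) = - X t" if t: "t \<in> I" for t
  proof -
    have "((\<lambda>t. transpose (U t) ** U t) has_vector_derivative
        transpose (U t) ** U' t + transpose (U' t) ** U t) (at t within I)"
      by (intro matrix_mult.has_vector_derivative dtranspose U'(1) t)
    moreover have "((\<lambda>t. transpose (U t) ** U t) has_vector_derivative 0) (at t within I)"
      by (rule has_vector_derivative_transform[where f = "\<lambda>t. mat 1"]) (use t orth in auto)
    ultimately have "transpose (U t) ** U' t + transpose (U' t) ** U t = 0"
      by (rule vector_derivative_unique_within[OF nt[OF t]])
    then show ?thesis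
      by (simp add: X_def matrix_transpose_mul eq_neg_iff_add_eq_0 add.commute)
  qed
  have skew_entry: "X t $ j $ i = - X t $ i $ j" if "t \<in> I" for t i j
    using arg_cong[OF skew[OF that], of "\<lambda>A. A $ i $ j"] by (simp add: transpose_def)
  \<comment> \<open>The plane rotations give the entries off the diagonal, skewness those on it.\<close>
  have X_const: "X s = X t" if st: "s \<in> I" "t \<in> I" for s t
  proof -
    have "X s $ i $ j = X t $ i $ j" for i j
    proof (cases "i = j")
      case True
      then show ?thesis using skew_entry[of s i i] skew_entry[of t i i] st by simp
    next
      case False
      have "- k / 2 * (X s $ j $ i - X s $ i $ j) = - k / 2 * (X t $ j $ i - X t $ i $ j)"
        using momentum[OF st one_parameter_group_plane_rotation[OF False]
            one_parameter_group_trivial[OF mat_1_in_Diag_pos]]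
        by (simp add: matrix_mult.diff_right trace_sub trace_mult_matrix_unit
            matrix_mult.zero_right)
      then show ?thesis
        using assms(2) skew_entry[of s j i] skew_entry[of t j i] st by simp
    qed
    then show ?thesis by (simp add: vec_eq_iff)
  qed
  have \<Lambda>_const: "\<Lambda> s $ i $ i = \<Lambda> t $ i $ i" if st: "s \<in> I" "t \<in> I" for s t i
    using momentum[OF st one_parameter_group_trivial[OF mat_1_in_SO] one_parameter_group_dilation]
    by (simp add: trace_mult_matrix_unit matrix_mult.zero_right)
  \<comment> \<open>By definition D' = D \<Lambda>, and D' is diagonal because D is.\<close>
  have D'_entry: "D' t $ i $ j = (if i = j then D t $ i $ i * \<Lambda> t $ i $ i else 0)"
    if t: "t \<in> I" for t i j
  proof (cases "i = j")
    case True
    have "D t ** matrix_inv (D t) = mat 1"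
      using matrix_inv_Diag_pos(2)[OF DI[OF t]] matrix_left_right_inverse by blast
    then have "D' t = D t ** \<Lambda> t"
      by (simp add: \<Lambda>_def matrix_mul_assoc)
    then show ?thesis
      using True Diag_pos_mult_entry(1)[OF DI[OF t]] by simp
  next
    case False
    have "((\<lambda>t. D t $ i $ j) has_vector_derivative D' t $ i $ j) (at t within I)"
      using bounded_linear.has_vector_derivative[OF bounded_linear_entry D'(1)[OF t]] .
    moreover have "((\<lambda>t. D t $ i $ j) has_vector_derivative 0) (at t within I)"
      by (rule has_vector_derivative_transform[where f = "\<lambda>t. 0"])
        (use t DI False in \<open>auto simp: Diag_pos_def\<close>)
    ultimately show ?thesis
      using False vector_derivative_unique_within[OF nt[OF t]] by auto
  qed
  define Z where "Z = (\<lambda>t. X t ** D t - D t ** X t + D' t)"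
  have F\<gamma>: "F \<circ> \<gamma> = (\<lambda>t. U t ** D t ** transpose (U t))"
    by (simp add: \<gamma> F_def comp_def)
  have dF: "((F \<circ> \<gamma>) has_vector_derivative U t ** Z t ** transpose (U t)) (at t within I)"
    if t: "t \<in> I" for t
  proof -
    have "((F \<circ> \<gamma>) has_vector_derivative
        U t ** D t ** transpose (U' t) + (U t ** D' t + U' t ** D t) ** transpose (U t))
        (at t within I)"
      unfolding F\<gamma> by (intro matrix_mult.has_vector_derivative dtranspose U'(1) D'(1) t)
    moreover have "U' t = U t ** X t"
      by (simp add: X_def matrix_mul_assoc orth[OF t])
    ultimately show ?thesis
      by (simp add: Z_def matrix_transpose_mul skew[OF t] matrix_mult.add_left
          matrix_mult.add_right matrix_mult.diff_left matrix_mult.diff_right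
          matrix_mult.minus_left matrix_mult.minus_right matrix_mul_assoc algebra_simps)
  qed
  have "(F \<circ> \<gamma>) ` I \<subseteq> Sym_pos"
    using F_in_Sym_pos UI DI by (auto simp: \<gamma>)
  moreover have "immersion_on I (F \<circ> \<gamma>) \<or> (F \<circ> \<gamma>) constant_on I"
  proof (cases "\<exists>t0\<in>I. U t0 ** Z t0 ** transpose (U t0) = 0")
    case True
    then obtain t0 where t0: "t0 \<in> I" "U t0 ** Z t0 ** transpose (U t0) = 0" by blast
    have "Z t0 = (transpose (U t0) ** U t0) ** Z t0 ** (transpose (U t0) ** U t0)"
      by (simp add: orth[OF t0(1)])
    also have "\<dots> = transpose (U t0) ** (U t0 ** Z t0 ** transpose (U t0)) ** U t0"
      by (simp only: matrix_mul_assoc)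
    finally have Z0: "Z t0 = 0"
      by (simp add: t0(2) matrix_mult.zero_left matrix_mult.zero_right)
    \<comment> \<open>The commutator of X with a diagonal matrix has zero diagonal, so Z = 0 splits in two equations: D' = 0 and X D = D X.\<close>
    have "\<Lambda> t0 $ i $ i = 0" for i
    proof -
      have "Z t0 $ i $ i = D' t0 $ i $ i"
        using Diag_pos_mult_entry[OF DI[OF t0(1)]] by (simp add: Z_def)
      with Z0 D'_entry[OF t0(1), of i i] have "D t0 $ i $ i * \<Lambda> t0 $ i $ i = 0"
        by simp
      moreover have "D t0 $ i $ i > 0"
        using DI[OF t0(1)] by (simp add: Diag_pos_def)
      ultimately show ?thesis by simp
    qed
    then have D'0: "D' t = 0" if "t \<in> I" for t
      using D'_entry[OF that] \<Lambda>_const[OF that t0(1)] by (simp add: vec_eq_iff)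
    obtain C where C: "\<And>t. t \<in> I \<Longrightarrow> D t = C"
      using has_vector_derivative_zero_constant[of I D] D'(1) D'0 is_interval_convex[OF assms(3)]
      by metis
    have "Z t = 0" if "t \<in> I" for t
      using Z0 X_const[OF that t0(1)] C[OF that] C[OF t0(1)] D'0[OF that] D'0[OF t0(1)]
      by (simp add: Z_def)
    then have "((F \<circ> \<gamma>) has_vector_derivative 0) (at t within I)" if "t \<in> I" for t
      using dF[OF that] that by (simp add: matrix_mult.zero_left matrix_mult.zero_right)
    then have "(F \<circ> \<gamma>) constant_on I"
      using has_vector_derivative_zero_constant[of I "F \<circ> \<gamma>"] is_interval_convex[OF assms(3)]
      unfolding constant_on_def by metis
    then show ?thesis ..
  next
    case False
    have "smooth_on I (F \<circ> \<gamma>)"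
      using sm unfolding F\<gamma> smooth_on_def
      by (intro allI Ck_on_bounded_bilinear[OF bounded_bilinear_matrix_mult]
          Ck_on_bounded_linear[OF bounded_linear_transpose]) simp_all
    moreover have "inj (\<lambda>h. h *\<^sub>R (U t ** Z t ** transpose (U t)))" if "t \<in> I" for t
      using False that by (auto intro!: injI)
    ultimately have "immersion_on I (F \<circ> \<gamma>)"
      using dF unfolding immersion_on_def has_vector_derivative_def by blast
    then show ?thesis ..
  qed
  ultimately show ?thesis ..
qed

end
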